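(* Let $G$ be a non-abelian finite simple group, and suppose that every maximal subgroup of $G$ has even order. Then the non-commuting, non-generating graph $\Xi(G)$ is connected with diameter at most $5$.
   Context: For a group $G$, the non-commuting, non-generating graph $\Xi(G)$ is the graph with vertex set $G \setminus Z(G)$ in which $\{x,y\}$ is an edge if and only if $[x,y] \neq 1$ and $\langle x,y\rangle \neq G$. *)

theory Defs
  imports
    "HOL-Algebra.SimpleGroups"
    "HOL-Algebra.Generated_Groups"
    "HOL-Library.Extended_Nat"
    "Graph_Theory.Digraph_Component"
begin

section \<open>Groups\<close>

definition center :: "('a, 'b) monoid_scheme \<Rightarrow> 'a set" where
  "center G = {z \<in> carrier G. \<forall>g \<in> carrier G. z \<otimes>\<^bsub>G\<^esub> g = g \<otimes>\<^bsub>G\<^esub> z}"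

text \<open>The convention is that of \<^const>\<open>derived\<close>. With the other usual convention
  (inverses on the left) the commutator is trivial for the same pairs of elements.\<close>

definition commutator :: "('a, 'b) monoid_scheme \<Rightarrow> 'a \<Rightarrow> 'a \<Rightarrow> 'a" where
  "commutator G x y = x \<otimes>\<^bsub>G\<^esub> y \<otimes>\<^bsub>G\<^esub> inv\<^bsub>G\<^esub> x \<otimes>\<^bsub>G\<^esub> inv\<^bsub>G\<^esub> y"

definition maximal_subgroup :: "'a set \<Rightarrow> ('a, 'b) monoid_scheme \<Rightarrow> bool" where
  "maximal_subgroup M G \<longleftrightarrow> subgroup M G \<and> M \<noteq> carrier G \<and>
     (\<forall>H. subgroup H G \<longrightarrow> M \<subseteq> H \<longrightarrow> H = M \<or> H = carrier G)"


section \<open>Distance and diameter\<close>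

text \<open>Length of a shortest walk; the infimum of the empty set is \<open>\<infinity>\<close>, so vertices that are not
  joined by a walk are at infinite distance. A graph has infinite diameter if the distances
  between its vertices are unbounded, in particular if it is disconnected.\<close>

definition graph_dist :: "('a, 'b) pre_digraph \<Rightarrow> 'a \<Rightarrow> 'a \<Rightarrow> enat" where
  "graph_dist \<Gamma> u v = (INF p \<in> {p. pre_digraph.awalk \<Gamma> u p v}. enat (length p))"

definition diameter :: "('a, 'b) pre_digraph \<Rightarrow> enat" where
  "diameter \<Gamma> = (SUP u \<in> verts \<Gamma>. SUP v \<in> verts \<Gamma>. graph_dist \<Gamma> u v)"


section \<open>The non-commuting, non-generating graph\<close>

text \<open>An undirected graph is represented by its symmetric digraph: an edge \<open>{x, y}\<close>
  is the pair of arcs \<open>(x, y)\<close> and \<open>(y, x)\<close>.\<close>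

definition ncng_graph :: "('a, 'b) monoid_scheme \<Rightarrow> 'a pair_pre_digraph" where
  "ncng_graph G = \<lparr>
     pverts = carrier G - center G,
     parcs = {(x, y). x \<in> carrier G - center G \<and> y \<in> carrier G - center G \<and>
                      commutator G x y \<noteq> \<one>\<^bsub>G\<^esub> \<and> generate G {x, y} \<noteq> carrier G} \<rparr>"

lemma (in group) commutator_eq_one_iff:
  assumes "x \<in> carrier G" "y \<in> carrier G"
  shows "commutator G x y = \<one> \<longleftrightarrow> x \<otimes> y = y \<otimes> x"
proof -
  have "commutator G x y = (x \<otimes> y) \<otimes> inv (y \<otimes> x)"
    using assms by (simp add: commutator_def inv_mult_group m_assoc)
  then show ?thesis
    using assms by (metis inv_closed inv_equality inv_inv m_closed r_inv)
qed

lemma (in group) pair_graph_ncng_graph: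
  assumes "finite (carrier G)"
  shows "pair_graph (ncng_graph G)"
proof
  show "finite (pverts (ncng_graph G))"
    using assms by (simp add: ncng_graph_def)
  show "finite (parcs (ncng_graph G))"
    by (rule finite_subset[of _ "carrier G \<times> carrier G"])
      (use assms in \<open>auto simp: ncng_graph_def\<close>)
  show "symmetric (ncng_graph G)"
    by (auto simp: symmetric_def sym_def ncng_graph_def commutator_eq_one_iff insert_commute)
qed (auto simp: ncng_graph_def commutator_eq_one_iff)

lemma graph_dist_le_iff:
  "graph_dist \<Gamma> u v \<le> enat n \<longleftrightarrow> (\<exists>p. pre_digraph.awalk \<Gamma> u p v \<and> length p \<le> n)"
proof
  assume le: "graph_dist \<Gamma> u v \<le> enat n"
  then have "(INF p \<in> {p. pre_digraph.awalk \<Gamma> u p v}. enat (length p)) < enat (Suc n)"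
    unfolding graph_dist_def by (rule le_less_trans) simp
  then show "\<exists>p. pre_digraph.awalk \<Gamma> u p v \<and> length p \<le> n"
    by (auto simp: INF_less_iff)
next
  assume "\<exists>p. pre_digraph.awalk \<Gamma> u p v \<and> length p \<le> n"
  then show "graph_dist \<Gamma> u v \<le> enat n"
    unfolding graph_dist_def by (auto intro: INF_lower2)
qed

end

theory Submission
  imports Defs "HOL-Algebra.Sylow" "HOL-Algebra.Multiplicative_Group"
begin

text \<open>
  Two noncommuting involutions are adjacent, since they generate a dihedral group. Two elements
  that are noncentral in a common proper subgroup are at distance at most 2, since a group is not
  the union of two proper subgroups. Every \<open>x \<noteq> \<one>\<close> is noncentral in some maximal subgroup:
  otherwise \<open>C\<^sub>G(x)\<close> would be a Frobenius complement of even order in \<open>G\<close>, and Bender's counting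
  argument would give a proper normal subgroup.

  If every maximal subgroup has a noncentral involution, then \<open>x\<close> and \<open>y\<close> are joined through
  noncentral involutions of maximal subgroups in which they are noncentral. If instead all
  involutions of some maximal subgroup are central in it, then all involutions of \<open>G\<close> are
  conjugate, they are pairwise adjacent, and their centralizers are maximal; in this case every
  \<open>x \<noteq> \<one>\<close> is at distance at most 2 from an involution.
\<close>

section \<open>Conjugation, centralizers and involutions\<close>

context group
begin

definition conjugate :: "'a \<Rightarrow> 'a \<Rightarrow> 'a" where
  "conjugate g x = g \<otimes> x \<otimes> inv g"

definition centralizer :: "'a set \<Rightarrow> 'a set" where
  "centralizer S = {g \<in> carrier G. \<forall>s \<in> S. g \<otimes> s = s \<otimes> g}"

definition involution :: "'a \<Rightarrow> bool" where
  "involution t \<longleftrightarrow> t \<in> carrier G \<and> t \<noteq> \<one> \<and> t \<otimes> t = \<one>"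

lemma inv_cancel_left [simp]:
  "\<lbrakk>g \<in> carrier G; x \<in> carrier G\<rbrakk> \<Longrightarrow> inv g \<otimes> (g \<otimes> x) = x"
  "\<lbrakk>g \<in> carrier G; x \<in> carrier G\<rbrakk> \<Longrightarrow> g \<otimes> (inv g \<otimes> x) = x"
  by (simp_all flip: m_assoc)

lemma conjugate_closed [simp]:
  "\<lbrakk>g \<in> carrier G; x \<in> carrier G\<rbrakk> \<Longrightarrow> conjugate g x \<in> carrier G"
  by (simp add: conjugate_def)

lemma conjugate_one [simp]: "g \<in> carrier G \<Longrightarrow> conjugate g \<one> = \<one>"
  by (simp add: conjugate_def)

lemma conjugate_by_one [simp]: "x \<in> carrier G \<Longrightarrow> conjugate \<one> x = x"
  by (simp add: conjugate_def)

lemma conjugate_mult: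
  "\<lbrakk>g \<in> carrier G; x \<in> carrier G; y \<in> carrier G\<rbrakk> \<Longrightarrow>
    conjugate g (x \<otimes> y) = conjugate g x \<otimes> conjugate g y"
  by (simp add: conjugate_def m_assoc)

lemma conjugate_inv:
  "\<lbrakk>g \<in> carrier G; x \<in> carrier G\<rbrakk> \<Longrightarrow> conjugate g (inv x) = inv (conjugate g x)"
  by (simp add: conjugate_def m_assoc inv_mult_group)

lemma conjugate_by_mult:
  "\<lbrakk>g \<in> carrier G; h \<in> carrier G; x \<in> carrier G\<rbrakk> \<Longrightarrow>
    conjugate (g \<otimes> h) x = conjugate g (conjugate h x)"
  by (simp add: conjugate_def m_assoc inv_mult_group)

lemma conjugate_cancel [simp]:
  "\<lbrakk>g \<in> carrier G; x \<in> carrier G\<rbrakk> \<Longrightarrow> conjugate (inv g) (conjugate g x) = x"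
  "\<lbrakk>g \<in> carrier G; x \<in> carrier G\<rbrakk> \<Longrightarrow> conjugate g (conjugate (inv g) x) = x"
  by (simp_all flip: conjugate_by_mult)

lemma conjugate_eq_iff:
  "\<lbrakk>g \<in> carrier G; x \<in> carrier G; y \<in> carrier G\<rbrakk> \<Longrightarrow> conjugate g x = conjugate g y \<longleftrightarrow> x = y"
  by (metis conjugate_cancel(1))

lemma conjugate_eq_one_iff [simp]:
  "\<lbrakk>g \<in> carrier G; x \<in> carrier G\<rbrakk> \<Longrightarrow> conjugate g x = \<one> \<longleftrightarrow> x = \<one>"
  by (metis conjugate_eq_iff conjugate_one one_closed)

lemma conjugate_eq_self_iff:
  "\<lbrakk>g \<in> carrier G; x \<in> carrier G\<rbrakk> \<Longrightarrow> conjugate g x = x \<longleftrightarrow> g \<otimes> x = x \<otimes> g"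
  by (simp add: conjugate_def inv_solve_right')

lemma conjugate_commute_iff:
  assumes "g \<in> carrier G" "x \<in> carrier G" "y \<in> carrier G"
  shows "conjugate g x \<otimes> conjugate g y = conjugate g y \<otimes> conjugate g x \<longleftrightarrow> x \<otimes> y = y \<otimes> x"
  using assms by (simp add: conjugate_eq_iff flip: conjugate_mult)

lemma conjugate_involution:
  "\<lbrakk>g \<in> carrier G; involution t\<rbrakk> \<Longrightarrow> involution (conjugate g t)"
  by (auto simp: involution_def simp flip: conjugate_mult)

lemma mem_conjugate_image_iff:
  assumes "g \<in> carrier G" "x \<in> carrier G" "H \<subseteq> carrier G"
  shows "x \<in> conjugate g ` H \<longleftrightarrow> conjugate (inv g) x \<in> H"
proof
  assume "conjugate (inv g) x \<in> H"
  then have "conjugate g (conjugate (inv g) x) \<in> conjugate g ` H" by blast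
  then show "x \<in> conjugate g ` H" using assms by simp
qed (use assms in auto)

lemma conjugate_image_mult:
  assumes "g \<in> carrier G" "h \<in> carrier G" "H \<subseteq> carrier G"
  shows "conjugate (g \<otimes> h) ` H = conjugate g ` (conjugate h ` H)"
  using assms by (auto simp: image_image conjugate_by_mult subset_iff intro!: image_cong)

lemma conjugate_image_one [simp]: "H \<subseteq> carrier G \<Longrightarrow> conjugate \<one> ` H = H"
  by (force simp: subset_iff)

lemma conjugate_image_cancel [simp]:
  assumes "g \<in> carrier G" "H \<subseteq> carrier G"
  shows "conjugate (inv g) ` (conjugate g ` H) = H" "conjugate g ` (conjugate (inv g) ` H) = H"
  using assms by (simp_all flip: conjugate_image_mult)

lemma inj_on_conjugate: "g \<in> carrier G \<Longrightarrow> H \<subseteq> carrier G \<Longrightarrow> inj_on (conjugate g) H"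
  by (auto simp: inj_on_def conjugate_eq_iff subset_iff)

lemma subgroup_conjugate_image:
  assumes "g \<in> carrier G" "subgroup H G"
  shows "subgroup (conjugate g ` H) G"
proof -
  have sub: "H \<subseteq> carrier G" using assms(2) by (rule subgroup.subset)
  show ?thesis
  proof (rule subgroupI)
    show "conjugate g ` H \<noteq> {}" using subgroup.one_closed[OF assms(2)] by auto
    show "inv a \<in> conjugate g ` H" if "a \<in> conjugate g ` H" for a
      using that assms sub
      by (auto simp: subset_iff simp flip: conjugate_inv intro!: imageI subgroup.m_inv_closed[OF assms(2)])
    show "a \<otimes> b \<in> conjugate g ` H" if "a \<in> conjugate g ` H" "b \<in> conjugate g ` H" for a b
      using that assms sub
      by (auto simp: subset_iff simp flip: conjugate_mult intro!: imageI subgroup.m_closed[OF assms(2)])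
  qed (use assms sub in auto)
qed

lemma conjugate_image_self:
  assumes "subgroup H G" "h \<in> H"
  shows "conjugate h ` H = H"
proof -
  have sub: "H \<subseteq> carrier G" using assms(1) by (rule subgroup.subset)
  have *: "conjugate k ` H \<subseteq> H" if "k \<in> H" for k
    using that assms(1) by (auto simp: conjugate_def subgroup.m_closed subgroup.m_inv_closed)
  have "H = conjugate h ` (conjugate (inv h) ` H)"
    using sub assms(2) by (simp add: subsetD)
  also have "\<dots> \<subseteq> conjugate h ` H"
    using *[OF subgroup.m_inv_closed[OF assms]] by (rule image_mono)
  finally show ?thesis using *[OF assms(2)] by blast
qed

lemma maximal_subgroup_conjugate:
  assumes "g \<in> carrier G" "maximal_subgroup M G"
  shows "maximal_subgroup (conjugate g ` M) G"
proof -
  have M: "subgroup M G" "M \<noteq> carrier G" "M \<subseteq> carrier G"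
    using assms(2) by (auto simp: maximal_subgroup_def subgroup.subset)
  have carrier: "conjugate k ` carrier G = carrier G" if "k \<in> carrier G" for k
    using that subgroup_self conjugate_image_self by blast
  show ?thesis
    unfolding maximal_subgroup_def
  proof (intro conjI allI impI)
    show "subgroup (conjugate g ` M) G"
      using M assms(1) by (simp add: subgroup_conjugate_image)
    show "conjugate g ` M \<noteq> carrier G"
    proof
      assume eq: "conjugate g ` M = carrier G"
      have "M = conjugate (inv g) ` (conjugate g ` M)" using M assms(1) by simp
      then show False using eq carrier[of "inv g"] assms(1) M(2) by simp
    qed
    fix H assume H: "subgroup H G" "conjugate g ` M \<subseteq> H"
    have Hsub: "H \<subseteq> carrier G" using H(1) by (rule subgroup.subset)
    have "conjugate (inv g) ` (conjugate g ` M) \<subseteq> conjugate (inv g) ` H"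
      using H(2) by (rule image_mono)
    then have "M \<subseteq> conjugate (inv g) ` H" using M assms(1) by simp
    moreover have "subgroup (conjugate (inv g) ` H) G"
      using H(1) assms(1) by (simp add: subgroup_conjugate_image)
    ultimately have "conjugate (inv g) ` H = M \<or> conjugate (inv g) ` H = carrier G"
      using assms(2) by (simp add: maximal_subgroup_def)
    then have "conjugate g ` (conjugate (inv g) ` H) = conjugate g ` M
        \<or> conjugate g ` (conjugate (inv g) ` H) = carrier G"
      using carrier[OF assms(1)] by metis
    then show "H = conjugate g ` M \<or> H = carrier G" using Hsub assms(1) by simp
  qed
qed

section \<open>Centralizers and normalizers\<close>

lemma subgroup_centralizer:
  assumes "S \<subseteq> carrier G"
  shows "subgroup (centralizer S) G"
proof (rule subgroupI)
  fix a assume a: "a \<in> centralizer S"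
  then have [simp]: "a \<in> carrier G" by (simp add: centralizer_def)
  show "inv a \<in> centralizer S"
    unfolding centralizer_def
  proof (intro CollectI conjI ballI)
    fix s assume "s \<in> S"
    then have s [simp]: "s \<in> carrier G" and eq: "a \<otimes> s = s \<otimes> a"
      using a assms by (auto simp: centralizer_def)
    have "inv a \<otimes> s = inv a \<otimes> (s \<otimes> a) \<otimes> inv a" by (simp add: m_assoc)
    also have "\<dots> = s \<otimes> inv a" by (simp flip: eq)
    finally show "inv a \<otimes> s = s \<otimes> inv a" .
  qed simp
  fix b assume b: "b \<in> centralizer S"
  then have [simp]: "b \<in> carrier G" by (simp add: centralizer_def)
  show "a \<otimes> b \<in> centralizer S"
    unfolding centralizer_def
  proof (intro CollectI conjI ballI)
    fix s assume "s \<in> S"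
    then have s [simp]: "s \<in> carrier G" and eq: "a \<otimes> s = s \<otimes> a" "b \<otimes> s = s \<otimes> b"
      using a b assms by (auto simp: centralizer_def)
    show "a \<otimes> b \<otimes> s = s \<otimes> (a \<otimes> b)" by (simp add: m_assoc eq(2)) (simp add: eq(1) flip: m_assoc)
  qed simp
qed (use assms in \<open>auto simp: centralizer_def subset_iff\<close>)

lemma conjugate_centralizer:
  assumes "g \<in> carrier G" "S \<subseteq> carrier G"
  shows "conjugate g ` centralizer S = centralizer (conjugate g ` S)"
proof (rule Set.set_eqI)
  fix x
  have sub: "centralizer S \<subseteq> carrier G" by (auto simp: centralizer_def)
  show "x \<in> conjugate g ` centralizer S \<longleftrightarrow> x \<in> centralizer (conjugate g ` S)"
  proof (cases "x \<in> carrier G")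
    case True
    have "conjugate (inv g) x \<otimes> s = s \<otimes> conjugate (inv g) x \<longleftrightarrow>
        x \<otimes> conjugate g s = conjugate g s \<otimes> x" if "s \<in> S" for s
      using conjugate_commute_iff[of g "conjugate (inv g) x" s] that True assms by auto
    then show ?thesis
      using True assms sub by (auto simp: mem_conjugate_image_iff) (auto simp: centralizer_def)
  qed (use sub assms in \<open>auto simp: centralizer_def\<close>)
qed

lemma subgroup_normalizer:
  assumes "H \<subseteq> carrier G"
  shows "subgroup {g \<in> carrier G. conjugate g ` H = H} G"
proof (rule subgroupI)
  show "inv a \<in> {g \<in> carrier G. conjugate g ` H = H}"
    if "a \<in> {g \<in> carrier G. conjugate g ` H = H}" for a
    using that assms conjugate_image_cancel(1)[of a H] by auto
  show "{g \<in> carrier G. conjugate g ` H = H} \<noteq> {}"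
    using assms conjugate_image_one by blast
qed (use assms in \<open>auto simp: conjugate_image_mult\<close>)

lemma mem_centralizer_singleton:
  "x \<in> centralizer {y} \<longleftrightarrow> x \<in> carrier G \<and> x \<otimes> y = y \<otimes> x"
  by (simp add: centralizer_def)

section \<open>Involutions and maximal subgroups of finite groups\<close>

lemma involution_inv: "involution t \<Longrightarrow> inv t = t"
  by (simp add: involution_def inv_equality)

text \<open>Cauchy's theorem for the prime 2, taken from Sylow's theorem in the form that yields a
  subgroup of order 2^a for every 2^a dividing the order; here a = 1.\<close>

lemma exists_involution:
  assumes "finite (carrier G)" "subgroup H G" "even (card H)"
  shows "\<exists>t \<in> H. involution t"
proof -
  interpret H: group "G\<lparr>carrier := H\<rparr>" using assms(2) by (rule subgroup_imp_group)
  have sub: "H \<subseteq> carrier G" using assms(2) by (rule subgroup.subset)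
  then have fin: "finite H" using assms(1) by (rule finite_subset)
  obtain m where m: "card H = 2 ^ 1 * m" using assms(3) by auto
  have "\<exists>K. subgroup K (G\<lparr>carrier := H\<rparr>) \<and> card K = 2 ^ 1"
    by (rule sylow_thm[where m = m]) (use m fin H.is_group in \<open>auto simp: order_def\<close>)
  then obtain K where K: "subgroup K (G\<lparr>carrier := H\<rparr>)" "card K = 2" by auto
  have "\<one> \<in> K" using subgroup.one_closed[OF K(1)] by simp
  with K(2) obtain t where t: "K = {\<one>, t}" "t \<noteq> \<one>"
    by (metis card_2_iff doubleton_eq_iff insertE singletonD)
  have tH: "t \<in> H" using subgroup.subset[OF K(1)] t by auto
  have "t \<otimes> t \<in> K" using subgroup.m_closed[OF K(1), of t t] t by simp
  then have "t \<otimes> t = \<one>" using t tH sub by auto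
  then show ?thesis using tH sub t by (auto simp: involution_def)
qed

lemma exists_maximal_subgroup:
  assumes "finite (carrier G)" "subgroup H G" "H \<noteq> carrier G"
  shows "\<exists>M. maximal_subgroup M G \<and> H \<subseteq> M"
proof -
  let ?A = "{K. subgroup K G \<and> K \<noteq> carrier G}"
  have "finite ?A"
    by (rule finite_subset[of _ "Pow (carrier G)"]) (use assms(1) subgroup.subset in auto)
  moreover have "H \<in> ?A" using assms by simp
  ultimately obtain M where M: "M \<in> ?A" "H \<subseteq> M" "\<forall>K \<in> ?A. M \<subseteq> K \<longrightarrow> M = K"
    using finite_has_maximal2 by (metis (no_types, lifting))
  then show ?thesis unfolding maximal_subgroup_def by blast
qed

text \<open>A group is not the union of two proper subgroups.\<close>

lemma exists_noncommuting_with_both: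
  assumes "subgroup H G" "x \<in> H" "y \<in> H"
    and "\<not> H \<subseteq> centralizer {x}" "\<not> H \<subseteq> centralizer {y}"
  shows "\<exists>h \<in> H. h \<otimes> x \<noteq> x \<otimes> h \<and> h \<otimes> y \<noteq> y \<otimes> h"
proof -
  have sub: "H \<subseteq> carrier G" using assms(1) by (rule subgroup.subset)
  obtain a b where a: "a \<in> H" "a \<notin> centralizer {x}" and b: "b \<in> H" "b \<notin> centralizer {y}"
    using assms by blast
  have X: "subgroup (centralizer {x}) G" and Y: "subgroup (centralizer {y}) G"
    using assms sub by (auto intro: subgroup_centralizer)
  have in_carrier: "a \<in> carrier G" "b \<in> carrier G" using a b sub by auto
  have "\<exists>h \<in> H. h \<notin> centralizer {x} \<and> h \<notin> centralizer {y}"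
  proof (cases "a \<in> centralizer {y} \<and> b \<in> centralizer {x}")
    case True
    \<comment> \<open>Here \<open>a\<close> commutes with \<open>y\<close> but not with
      \<open>x\<close>, and \<open>b\<close> with \<open>x\<close> but not with \<open>y\<close>.
      Solving for either factor shows that \<open>a \<otimes> b\<close> commutes with
      neither.\<close>
    have "a = a \<otimes> b \<otimes> inv b" "b = inv a \<otimes> (a \<otimes> b)"
      using in_carrier by (simp_all add: m_assoc)
    then have "a \<otimes> b \<notin> centralizer {x}" "a \<otimes> b \<notin> centralizer {y}"
      using True a b subgroup.m_closed[OF X] subgroup.m_inv_closed[OF X]
        subgroup.m_closed[OF Y] subgroup.m_inv_closed[OF Y] by metis+
    then show ?thesis using subgroup.m_closed[OF assms(1) a(1) b(1)] by blast
  qed (use a b in blast)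
  then show ?thesis using sub by (auto simp: mem_centralizer_singleton)
qed

text \<open>For \<open>u = ts\<close> of order \<open>n\<close>, the element \<open>u\<^sup>k\<close> is an involution commuting with \<open>t\<close> and \<open>s\<close>
  if \<open>n = 2k\<close>, and it conjugates \<open>t\<close> to \<open>s\<close> if \<open>n = 2k + 1\<close>.\<close>

lemma involutions_commute_or_conjugate:
  assumes "finite (carrier G)" "involution t" "involution s" "t \<noteq> s"
  shows "(\<exists>z. involution z \<and> z \<otimes> t = t \<otimes> z \<and> z \<otimes> s = s \<otimes> z) \<or> (\<exists>g \<in> carrier G. conjugate g t = s)"
proof -
  note t = assms(2)[unfolded involution_def] and s = assms(3)[unfolded involution_def]
  have [simp]: "t \<in> carrier G" "s \<in> carrier G" using t s by auto
  have tt [simp]: "t \<otimes> t = \<one>" "s \<otimes> s = \<one>" using t s by auto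
  have tt2 [simp]: "t \<otimes> (t \<otimes> x) = x" "s \<otimes> (s \<otimes> x) = x" if "x \<in> carrier G" for x
    using that by (simp_all flip: m_assoc)
  have inv_ts [simp]: "inv t = t" "inv s = s" using assms by (auto intro: involution_inv)
  define u where "u = t \<otimes> s"
  have [simp]: "u \<in> carrier G" by (simp add: u_def)
  have u1: "u \<noteq> \<one>" using assms(4) tt2(1)[of s] by (metis u_def \<open>s \<in> carrier G\<close> \<open>t \<in> carrier G\<close> r_one)
  have "\<exists>n. n > 0 \<and> u [^] (n::nat) = \<one>"
    using pow_order_eq_1[of u] assms(1) by (metis \<open>u \<in> carrier G\<close> order_gt_0_iff_finite)
  then obtain n :: nat where n: "n > 0" "u [^] n = \<one>" "\<And>m. m < n \<Longrightarrow> m > 0 \<Longrightarrow> u [^] m \<noteq> \<one>"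
    using exists_least_iff[of "\<lambda>n. n > 0 \<and> u [^] (n::nat) = \<one>"] by blast
  \<comment> \<open>\<open>t\<close> and \<open>s\<close> invert \<open>u\<close>, hence every power
    of \<open>u\<close>.\<close>
  have rev_t: "t \<otimes> u [^] k = inv (u [^] k) \<otimes> t" and rev_s: "s \<otimes> u [^] k = inv (u [^] k) \<otimes> s" for k :: nat
  proof (induction k)
    case (Suc k)
    { case 1
      have "t \<otimes> u [^] Suc k = (t \<otimes> u [^] k) \<otimes> u" by (simp add: m_assoc)
      also have "\<dots> = inv (u [^] k) \<otimes> (t \<otimes> u)" using Suc by (simp add: m_assoc)
      also have "t \<otimes> u = inv u \<otimes> t" by (simp add: u_def inv_mult_group m_assoc)
      also have "inv (u [^] k) \<otimes> (inv u \<otimes> t) = inv (u [^] Suc k) \<otimes> t"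
        by (subst nat_pow_Suc2) (simp_all add: inv_mult_group m_assoc)
      finally show ?case .
    next
      case 2
      have "s \<otimes> u [^] Suc k = (s \<otimes> u [^] k) \<otimes> u" by (simp add: m_assoc)
      also have "\<dots> = inv (u [^] k) \<otimes> (s \<otimes> u)" using Suc by (simp add: m_assoc)
      also have "s \<otimes> u = inv u \<otimes> s" by (simp add: u_def inv_mult_group m_assoc)
      also have "inv (u [^] k) \<otimes> (inv u \<otimes> s) = inv (u [^] Suc k) \<otimes> s"
        by (subst nat_pow_Suc2) (simp_all add: inv_mult_group m_assoc)
      finally show ?case . }
  qed simp_all
  show ?thesis
  proof (cases "even n")
    case True
    then obtain k where k: "n = k + k" by (metis evenE mult_2)
    let ?z = "u [^] k"
    have zz: "?z \<otimes> ?z = \<one>" using n(2) k by (simp add: nat_pow_mult)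
    then have "inv ?z = ?z" by (simp add: inv_equality)
    moreover have "?z \<noteq> \<one>" using n k by simp
    ultimately show ?thesis
      using rev_t[of k] rev_s[of k] zz by (auto simp: involution_def intro!: exI[of _ ?z])
  next
    case False
    then obtain k where k: "n = Suc (k + k)" by (metis oddE mult_2 Suc_eq_plus1)
    let ?z = "u [^] k"
    \<comment> \<open>This turns the conjugate of \<open>t\<close> by u^k into u^(2k) t, and u^(2k)
      is \<open>inv u\<close> because n = 2k + 1.\<close>
    have "t \<otimes> inv ?z = ?z \<otimes> t"
    proof -
      have "t \<otimes> inv ?z \<otimes> t = t \<otimes> (t \<otimes> ?z)" using rev_t[of k] by (simp add: m_assoc)
      then have "t \<otimes> inv ?z \<otimes> t \<otimes> t = ?z \<otimes> t" by simp
      then show ?thesis by (simp add: m_assoc)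
    qed
    then have "conjugate ?z t = ?z \<otimes> ?z \<otimes> t" by (simp add: conjugate_def m_assoc)
    moreover have "?z \<otimes> ?z = inv u"
      using n(2) k by (intro inv_equality[symmetric]) (simp_all add: nat_pow_mult)
    ultimately have "conjugate ?z t = inv u \<otimes> t" by simp
    also have "\<dots> = s" by (simp add: u_def inv_mult_group m_assoc)
    finally show ?thesis by (intro disjI2 bexI[of _ ?z]) simp_all
  qed
qed

end


section \<open>Simple groups whose maximal subgroups have even order\<close>

locale even_maximal_simple_group = simple_group +
  assumes finite_carrier: "finite (carrier G)"
    and nonabelian: "\<not> comm_group G"
    and even_maximal: "maximal_subgroup M G \<Longrightarrow> even (card M)"
begin

lemma maximal_subgroupD:
  assumes "maximal_subgroup M G"
  shows "subgroup M G" "M \<subseteq> carrier G" "M \<noteq> carrier G"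
  using assms by (auto simp: maximal_subgroup_def subgroup.subset)

lemma maximal_subgroup_eq:
  "\<lbrakk>maximal_subgroup M G; subgroup H G; H \<noteq> carrier G; M \<subseteq> H\<rbrakk> \<Longrightarrow> H = M"
  by (auto simp: maximal_subgroup_def)

lemma maximal_subgroup_has_involution:
  "maximal_subgroup M G \<Longrightarrow> \<exists>t \<in> M. involution t"
  using exists_involution[OF finite_carrier maximal_subgroupD(1) even_maximal] by blast

lemma invariant_subgroup_trivial:
  assumes "subgroup H G" "\<And>g. g \<in> carrier G \<Longrightarrow> conjugate g ` H = H"
  shows "H = {\<one>} \<or> H = carrier G"
proof -
  have "H \<lhd> G"
    by (rule normal_invI) (use assms in \<open>auto simp: conjugate_def\<close>)
  then show ?thesis using no_real_normal_subgroup by blast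
qed

text \<open>The normalizer of \<open>H\<close> contains \<open>M\<close> and is proper by
  simplicity, so maximality makes it equal to \<open>M\<close>.\<close>

lemma normalizer_of_normal_in_maximal:
  assumes "maximal_subgroup M G" "subgroup H G" "H \<noteq> {\<one>}" "H \<noteq> carrier G"
    and "\<And>m. m \<in> M \<Longrightarrow> conjugate m ` H = H"
    and "g \<in> carrier G" "conjugate g ` H = H"
  shows "g \<in> M"
proof -
  let ?N = "{g \<in> carrier G. conjugate g ` H = H}"
  have "subgroup ?N G" by (rule subgroup_normalizer) (rule subgroup.subset[OF assms(2)])
  moreover have "?N \<noteq> carrier G" using invariant_subgroup_trivial[OF assms(2)] assms(3,4) by blast
  moreover have "M \<subseteq> ?N" using assms(5) maximal_subgroupD(2)[OF assms(1)] by auto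
  ultimately have "?N = M" by (rule maximal_subgroup_eq[OF assms(1)])
  then show ?thesis using assms(6,7) by blast
qed

text \<open>The case \<open>H = M\<close> of the previous lemma; \<open>M\<close> is nontrivial
  because its order is even.\<close>

lemma maximal_subgroup_self_normalizing:
  assumes "maximal_subgroup M G" "g \<in> carrier G" "conjugate g ` M = M"
  shows "g \<in> M"
proof (rule normalizer_of_normal_in_maximal[OF assms(1) _ _ _ _ assms(2,3)])
  show "M \<noteq> {\<one>}" using even_maximal[OF assms(1)] by auto
qed (use maximal_subgroupD[OF assms(1)] conjugate_image_self in auto)

text \<open>The center is invariant under conjugation, so by simplicity a nontrivial central element
  would make \<open>G\<close> abelian.\<close>

lemma centralizer_proper:
  assumes "x \<in> carrier G" "x \<noteq> \<one>"
  shows "centralizer {x} \<noteq> carrier G"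
proof
  assume eq: "centralizer {x} = carrier G"
  have sub: "subgroup (centralizer (carrier G)) G" by (rule subgroup_centralizer) simp
  have "centralizer (carrier G) = {\<one>} \<or> centralizer (carrier G) = carrier G"
  proof (rule invariant_subgroup_trivial[OF sub])
    fix g assume "g \<in> carrier G"
    then have "conjugate g ` carrier G = carrier G"
      using conjugate_image_self subgroup_self by blast
    then show "conjugate g ` centralizer (carrier G) = centralizer (carrier G)"
      using \<open>g \<in> carrier G\<close> by (simp add: conjugate_centralizer)
  qed
  moreover have "x \<in> centralizer (carrier G)"
  proof -
    have "x \<otimes> s = s \<otimes> x" if "s \<in> carrier G" for s
    proof -
      have "s \<in> centralizer {x}" using that eq by simp
      then show ?thesis by (simp add: mem_centralizer_singleton)
    qed
    then show ?thesis using assms(1) by (simp add: centralizer_def)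
  qed
  ultimately have "centralizer (carrier G) = carrier G" using assms(2) by blast
  then have "comm_group G"
    by (intro group_comm_groupI) (auto simp: centralizer_def)
  then show False using nonabelian by contradiction
qed

lemma maximal_subgroup_eq_centralizer:
  assumes "maximal_subgroup M G" "x \<in> carrier G" "x \<noteq> \<one>" "M \<subseteq> centralizer {x}"
  shows "M = centralizer {x}"
  using maximal_subgroup_eq[OF assms(1) _ centralizer_proper[OF assms(2,3)] assms(4)]
    subgroup_centralizer assms(2) by simp

lemma exists_maximal_above_centralizer:
  assumes "x \<in> carrier G" "x \<noteq> \<one>"
  shows "\<exists>M. maximal_subgroup M G \<and> centralizer {x} \<subseteq> M \<and> x \<in> M"
proof -
  have "subgroup (centralizer {x}) G" using assms(1) by (simp add: subgroup_centralizer)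
  then obtain M where M: "maximal_subgroup M G" "centralizer {x} \<subseteq> M"
    using exists_maximal_subgroup[OF finite_carrier _ centralizer_proper[OF assms]] by blast
  moreover have "x \<in> centralizer {x}" using assms(1) by (simp add: mem_centralizer_singleton)
  ultimately show ?thesis by blast
qed

text \<open>The rotations of a dihedral group form an abelian normal subgroup.\<close>

lemma involutions_generate_proper:
  assumes "involution t" "involution s" "t \<otimes> s \<noteq> s \<otimes> t"
  shows "generate G {t, s} \<noteq> carrier G"
proof
  assume gen: "generate G {t, s} = carrier G"
  have [simp]: "t \<in> carrier G" "s \<in> carrier G" and tt [simp]: "t \<otimes> t = \<one>" "s \<otimes> s = \<one>"
    using assms by (auto simp: involution_def)
  have [simp]: "inv t = t" "inv s = s" using assms by (auto intro: involution_inv)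
  have tt2 [simp]: "t \<otimes> (t \<otimes> x) = x" "s \<otimes> (s \<otimes> x) = x" if "x \<in> carrier G" for x
    using that by (simp_all flip: m_assoc)
  define u where "u = t \<otimes> s"
  define H where "H = generate G {u}"
  have [simp]: "u \<in> carrier G" by (simp add: u_def)
  have H: "subgroup H G" unfolding H_def by (rule generate_is_subgroup) simp
  have Hsub: "H \<subseteq> carrier G" using H by (rule subgroup.subset)
  have "u \<in> H" unfolding H_def by (rule generate.incl) simp
  \<comment> \<open>Both generators invert the rotation \<open>u\<close>, so they normalize
    \<open>H\<close>.\<close>
  have inv_u: "conjugate r u = inv u" if "r \<in> {t, s}" for r
    using that by (auto simp: conjugate_def u_def inv_mult_group m_assoc)
  have stable: "conjugate r ` H = H" if r: "r \<in> {t, s}" for r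
  proof -
    have [simp]: "r \<in> carrier G" "inv r = r" using r by auto
    have "subgroup (conjugate r ` H) G" using H by (simp add: subgroup_conjugate_image)
    moreover have "u \<in> conjugate r ` H"
    proof -
      have "conjugate r (inv u) = u" using inv_u[OF r] conjugate_inv[of r u] by simp
      then show ?thesis using subgroup.m_inv_closed[OF H \<open>u \<in> H\<close>] by (metis imageI)
    qed
    ultimately have le: "H \<subseteq> conjugate r ` H"
      unfolding H_def by (intro generate_subgroup_incl) auto
    then have "conjugate r ` H \<subseteq> conjugate r ` (conjugate r ` H)" by (rule image_mono)
    also have "\<dots> = H" using conjugate_image_cancel(1)[of r H] Hsub by simp
    finally show ?thesis using le by blast
  qed
  have "carrier G \<subseteq> {g \<in> carrier G. conjugate g ` H = H}"
    unfolding gen[symmetric]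
    by (rule generate_subgroup_incl) (use stable subgroup_normalizer[OF Hsub] in \<open>auto simp: gen\<close>)
  then have "H = {\<one>} \<or> H = carrier G"
    using invariant_subgroup_trivial[OF H] by blast
  then show False
  proof
    assume "H = {\<one>}"
    then have "t \<otimes> s = \<one>" using \<open>u \<in> H\<close> u_def by simp
    then have "s = t" using tt2(1)[of s] by simp
    then show False using assms(3) by simp
  next
    \<comment> \<open>\<open>H\<close> is cyclic. If it were all of \<open>G\<close>, then
      \<open>t\<close> would commute with \<open>u = t \<otimes> s\<close>, hence with
      \<open>s\<close>.\<close>
    assume "H = carrier G"
    moreover have "H \<subseteq> centralizer {u}"
      unfolding H_def
      by (rule generate_subgroup_incl) (auto simp: mem_centralizer_singleton intro: subgroup_centralizer)
    ultimately have "t \<in> centralizer {u}" by auto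
    then have "t \<otimes> u = u \<otimes> t" by (simp add: mem_centralizer_singleton)
    then have "s = t \<otimes> (s \<otimes> t)" by (simp add: u_def m_assoc)
    then have "t \<otimes> s = t \<otimes> (t \<otimes> (s \<otimes> t))" by metis
    then show False using assms(3) by simp
  qed
qed

text \<open>Otherwise \<open>G\<close> is a Frobenius group with a complement of even order. Bender's argument:
  the complement \<open>K\<close> of the union of the conjugates of \<open>L - {\<one>}\<close> has as many
  elements as \<open>L\<close> has conjugates, and it contains all products \<open>\<tau>\<^sub>0 \<tau>\<close> of a fixed involution
  and a representative involution of each conjugate; hence it is a normal subgroup.\<close>

lemma maximal_subgroup_meets_conjugate:
  assumes L: "maximal_subgroup L G"
  shows "\<exists>g \<in> carrier G - L. \<exists>z \<in> L \<inter> conjugate g ` L. z \<noteq> \<one>"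
proof (rule ccontr)
  assume "\<not> ?thesis"
  \<comment> \<open>\<open>L\<close> has the trivial intersection property; being self-normalizing
    as well, it is a Frobenius complement.\<close>
  then have TI: "z = \<one>" if "g \<in> carrier G" "g \<notin> L" "z \<in> L" "z \<in> conjugate g ` L" for g z
    using that by blast
  note Lsub = maximal_subgroupD(2)[OF L]
  define \<C> where "\<C> = (\<lambda>g. conjugate g ` L) ` carrier G"
  have max: "maximal_subgroup H G" if "H \<in> \<C>" for H
    using that L by (auto simp: \<C>_def maximal_subgroup_conjugate)
  have sub: "H \<subseteq> carrier G" if "H \<in> \<C>" for H using max[OF that] maximal_subgroupD by blast
  have conj_\<C>: "conjugate g ` H \<in> \<C>" if "H \<in> \<C>" "g \<in> carrier G" for g H
    using that Lsub by (auto simp: \<C>_def simp flip: conjugate_image_mult)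
  \<comment> \<open>\<open>L\<close> is its own normalizer, so its conjugates correspond to its left
    cosets.\<close>
  have conj_eq: "conjugate a ` L = conjugate b ` L \<longleftrightarrow> inv a \<otimes> b \<in> L"
    if "a \<in> carrier G" "b \<in> carrier G" for a b
  proof
    assume "conjugate a ` L = conjugate b ` L"
    then have "conjugate (inv a) ` (conjugate a ` L) = conjugate (inv a \<otimes> b) ` L"
      using that Lsub by (simp add: conjugate_image_mult)
    then show "inv a \<otimes> b \<in> L"
      using that Lsub by (intro maximal_subgroup_self_normalizing[OF L]) auto
  next
    assume "inv a \<otimes> b \<in> L"
    then have "conjugate a ` L = conjugate a ` (conjugate (inv a \<otimes> b) ` L)"
      using conjugate_image_self[OF maximal_subgroupD(1)[OF L]] by simp
    also have "\<dots> = conjugate b ` L"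
      using that Lsub by (simp flip: conjugate_image_mult)
    finally show "conjugate a ` L = conjugate b ` L" .
  qed
  have disj: "H1 = H2" if H: "H1 \<in> \<C>" "H2 \<in> \<C>" and z: "z \<in> H1" "z \<in> H2" "z \<noteq> \<one>" for H1 H2 z
  proof -
    obtain a b where a: "a \<in> carrier G" "H1 = conjugate a ` L" and b: "b \<in> carrier G" "H2 = conjugate b ` L"
      using H by (auto simp: \<C>_def)
    have zc: "z \<in> carrier G" using z(1) sub[OF H(1)] by blast
    have "conjugate (inv a) z \<in> L"
      using z(1) zc a Lsub by (simp add: mem_conjugate_image_iff)
    moreover have "conjugate (inv a) z \<in> conjugate (inv a \<otimes> b) ` L"
      using z(2) a b Lsub by (simp add: conjugate_image_mult)
    moreover have "conjugate (inv a) z \<noteq> \<one>" using z(3) zc a by simp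
    ultimately have "inv a \<otimes> b \<in> L" using TI[of "inv a \<otimes> b"] a b by auto
    then show ?thesis using conj_eq a b by simp
  qed
  have fin\<C>: "finite \<C>" unfolding \<C>_def using finite_carrier by simp
  have finH: "finite H" if "H \<in> \<C>" for H using sub[OF that] finite_carrier by (rule finite_subset)
  have cardH: "card H = card L" if "H \<in> \<C>" for H
    using that Lsub by (auto simp: \<C>_def card_image inj_on_conjugate)
  have card_carrier: "card (carrier G) = card \<C> * card L"
  proof -
    \<comment> \<open>The fibre \<open>F H\<close> is a left coset of \<open>L\<close>; summing over
      \<open>\<C>\<close> gives the orbit-stabilizer count.\<close>
    define F where "F H = {g \<in> carrier G. conjugate g ` L = H}" for H
    have "card (F H) = card L" if H: "H \<in> \<C>" for H
    proof -
      obtain a where a: "a \<in> carrier G" "H = conjugate a ` L" using H by (auto simp: \<C>_def)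
      have "F H = (\<lambda>l. a \<otimes> l) ` L"
      proof (intro Set.set_eqI iffI)
        fix g assume "g \<in> F H"
        then have "g \<in> carrier G" "inv a \<otimes> g \<in> L" using a conj_eq[of a g] by (auto simp: F_def)
        then show "g \<in> (\<lambda>l. a \<otimes> l) ` L" using a by (intro image_eqI[of _ _ "inv a \<otimes> g"]) auto
      next
        fix g assume "g \<in> (\<lambda>l. a \<otimes> l) ` L"
        then obtain l where l: "l \<in> L" "g = a \<otimes> l" by blast
        then have "l \<in> carrier G" using Lsub by blast
        then show "g \<in> F H" using a conj_eq[of a g] l by (auto simp: F_def)
      qed
      moreover have "inj_on (\<lambda>l. a \<otimes> l) L" using a Lsub by (auto simp: inj_on_def subset_iff)
      ultimately show ?thesis by (simp add: card_image)
    qed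
    moreover have "carrier G = (\<Union>H \<in> \<C>. F H)" by (auto simp: F_def \<C>_def)
    moreover have "card (\<Union>H \<in> \<C>. F H) = (\<Sum>H \<in> \<C>. card (F H))"
      by (rule card_UN_disjoint) (use fin\<C> finite_carrier in \<open>auto simp: F_def\<close>)
    ultimately show ?thesis by simp
  qed
  \<comment> \<open>The candidate for the Frobenius kernel, defined so that \<open>\<one>\<close>
    belongs to it.\<close>
  define K where "K = {k \<in> carrier G. \<forall>H \<in> \<C>. k \<in> H \<longrightarrow> k = \<one>}"
  have cardK: "card K = card \<C>"
  proof -
    have Ksub: "K \<subseteq> carrier G" by (auto simp: K_def)
    have "carrier G - K = (\<Union>H \<in> \<C>. H - {\<one>})" using sub by (auto simp: K_def)
    also have "card \<dots> = (\<Sum>H \<in> \<C>. card (H - {\<one>}))"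
      by (rule card_UN_disjoint) (use fin\<C> finH disj in auto)
    also have "\<dots> = (\<Sum>H \<in> \<C>. card L - 1)"
    proof (rule sum.cong)
      fix H assume "H \<in> \<C>"
      moreover from this have "\<one> \<in> H" using subgroup.one_closed maximal_subgroupD(1) max by blast
      ultimately show "card (H - {\<one>}) = card L - 1" by (simp add: cardH)
    qed simp
    \<comment> \<open>Since \<open>card (carrier G) = card \<C> * card L\<close>, exactly
      \<open>card \<C>\<close> elements are left for \<open>K\<close>.\<close>
    finally have "card (carrier G) - card K = card \<C> * (card L - 1)"
      using Ksub finite_carrier by (simp add: card_Diff_subset finite_subset)
    moreover have "card K \<le> card (carrier G)" using Ksub finite_carrier by (simp add: card_mono)
    moreover have "card L > 0"
      using subgroup.one_closed[OF maximal_subgroupD(1)[OF L]] Lsub finite_carrier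
      by (metis card_gt_0_iff empty_iff finite_subset)
    ultimately show ?thesis unfolding card_carrier by (cases "card L") auto
  qed
  \<comment> \<open>One involution from each conjugate; by \<open>disj\<close>, distinct conjugates
    receive distinct involutions.\<close>
  obtain \<tau> where \<tau>: "\<And>H. H \<in> \<C> \<Longrightarrow> \<tau> H \<in> H" "\<And>H. H \<in> \<C> \<Longrightarrow> involution (\<tau> H)"
    using maximal_subgroup_has_involution[OF max] by metis
  have \<tau>c: "\<tau> H \<in> carrier G" "\<tau> H \<noteq> \<one>" "\<tau> H \<otimes> \<tau> H = \<one>" "inv (\<tau> H) = \<tau> H" if "H \<in> \<C>" for H
    using \<tau>(2)[OF that] by (auto simp: involution_def involution_inv)
  have \<tau>\<tau>: "\<tau> H \<otimes> (\<tau> H \<otimes> x) = x" if "H \<in> \<C>" "x \<in> carrier G" for H x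
    using that \<tau>c[OF that(1)] by (simp flip: m_assoc)
  have prodK: "\<tau> H1 \<otimes> \<tau> H2 \<in> K" if H12: "H1 \<in> \<C>" "H2 \<in> \<C>" for H1 H2
    unfolding K_def
  proof (intro CollectI conjI ballI impI)
    show "\<tau> H1 \<otimes> \<tau> H2 \<in> carrier G" using H12 \<tau>c by simp
    fix H assume H: "H \<in> \<C>" and mem: "\<tau> H1 \<otimes> \<tau> H2 \<in> H"
    let ?z = "\<tau> H1 \<otimes> \<tau> H2"
    show "?z = \<one>"
    proof (rule ccontr)
      assume ne: "?z \<noteq> \<one>"
      have sg: "subgroup H G" using max[OF H] maximal_subgroupD by blast
      \<comment> \<open>\<open>\<tau> H1\<close> inverts \<open>?z\<close>, so \<open>H\<close> and
        its conjugate by \<open>\<tau> H1\<close> share a nontrivial element and coincide. Hence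
        \<open>\<tau> H1\<close> and then \<open>\<tau> H2\<close> lie in \<open>H\<close>, which
        forces \<open>H1 = H = H2\<close> and \<open>?z = \<one>\<close>.\<close>
      have "conjugate (\<tau> H1) ?z = inv ?z"
        using \<tau>c H12 by (simp add: conjugate_def inv_mult_group m_assoc \<tau>\<tau>)
      then have "inv ?z \<in> conjugate (\<tau> H1) ` H" using mem by (metis imageI)
      moreover have "inv ?z \<in> H" using mem sg by (simp add: subgroup.m_inv_closed)
      moreover have "inv ?z \<noteq> \<one>" using ne \<tau>c H12 by (metis inv_inv inv_one m_closed)
      ultimately have "conjugate (\<tau> H1) ` H = H"
        using disj[of "conjugate (\<tau> H1) ` H" H] conj_\<C> H \<tau>c H12 by blast
      then have 1: "\<tau> H1 \<in> H"
        using maximal_subgroup_self_normalizing[OF max[OF H]] \<tau>c H12 by blast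
      have "\<tau> H2 = \<tau> H1 \<otimes> ?z" using \<tau>\<tau>[of H1 "\<tau> H2"] \<tau>c H12 by simp
      then have 2: "\<tau> H2 \<in> H" using 1 mem subgroup.m_closed[OF sg] by metis
      have "H1 = H" by (rule disj[OF H12(1) H \<tau>(1) 1 \<tau>c(2)]) fact+
      moreover have "H2 = H" by (rule disj[OF H12(2) H \<tau>(1) 2 \<tau>c(2)]) fact+
      ultimately show False using ne \<tau>c H by simp
    qed
  qed
  \<comment> \<open>For each choice of \<open>H0\<close> the products are \<open>card \<C>\<close>
    distinct elements of \<open>K\<close>, hence all of it.\<close>
  have K_eq: "K = (\<lambda>H. \<tau> H0 \<otimes> \<tau> H) ` \<C>" if H0: "H0 \<in> \<C>" for H0
  proof -
    have "inj_on (\<lambda>H. \<tau> H0 \<otimes> \<tau> H) \<C>"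
    proof (rule inj_onI)
      fix H1 H2 assume H: "H1 \<in> \<C>" "H2 \<in> \<C>" and "\<tau> H0 \<otimes> \<tau> H1 = \<tau> H0 \<otimes> \<tau> H2"
      then have "\<tau> H1 = \<tau> H2" using \<tau>c H0 by simp
      then show "H1 = H2" using disj[OF H \<tau>(1)[OF H(1)]] \<tau>(1)[OF H(2)] \<tau>c(2)[OF H(1)] by simp
    qed
    then have "card ((\<lambda>H. \<tau> H0 \<otimes> \<tau> H) ` \<C>) = card K" by (simp add: card_image cardK)
    moreover have "finite K" using finite_carrier by (auto simp: K_def)
    moreover have "(\<lambda>H. \<tau> H0 \<otimes> \<tau> H) ` \<C> \<subseteq> K" using prodK H0 by blast
    ultimately show ?thesis by (metis card_subset_eq)
  qed
  have LC: "L \<in> \<C>" unfolding \<C>_def using conjugate_image_one[OF Lsub] by (metis imageI one_closed)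
  have subK: "subgroup K G"
  proof (rule subgroupI)
    show "K \<subseteq> carrier G" by (auto simp: K_def)
    show "K \<noteq> {}" using prodK LC by blast
  next
    fix a assume "a \<in> K"
    then obtain H where H: "H \<in> \<C>" "a = \<tau> L \<otimes> \<tau> H" using K_eq[OF LC] by blast
    then have "inv a = \<tau> H \<otimes> \<tau> L" using \<tau>c LC by (simp add: inv_mult_group)
    then show "inv a \<in> K" using prodK H LC by simp
    fix b assume "b \<in> K"
    \<comment> \<open>Writing \<open>b\<close> with base \<open>H\<close> instead of
      \<open>L\<close> lets the two factors \<open>\<tau> H\<close> in \<open>a \<otimes> b\<close>
      cancel.\<close>
    then obtain H' where H': "H' \<in> \<C>" "b = \<tau> H \<otimes> \<tau> H'" using K_eq[OF H(1)] by blast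
    then have "a \<otimes> b = \<tau> L \<otimes> \<tau> H'" using H \<tau>c LC by (simp add: m_assoc \<tau>\<tau>)
    then show "a \<otimes> b \<in> K" using prodK H' LC by simp
  qed
  have "K \<lhd> G"
  proof (rule normal_invI[OF subK])
    fix g k assume g: "g \<in> carrier G" and k: "k \<in> K"
    then have kc: "k \<in> carrier G" by (simp add: K_def)
    have "conjugate g k = \<one>" if H: "H \<in> \<C>" "conjugate g k \<in> H" for H
    proof -
      have "k \<in> conjugate (inv g) ` H"
        using g kc H sub by (simp add: mem_conjugate_image_iff)
      then show ?thesis using conj_\<C>[OF H(1), of "inv g"] k g by (auto simp: K_def)
    qed
    then show "g \<otimes> k \<otimes> inv g \<in> K" using g kc by (auto simp: K_def simp flip: conjugate_def)
  qed
  then have "K = carrier G \<or> K = {\<one>}" by (rule no_real_normal_subgroup)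
  then show False
  proof
    assume "K = carrier G"
    then have "\<tau> L \<in> K" using \<tau>c LC by simp
    then show False using \<tau> \<tau>c LC by (auto simp: K_def)
  next
    assume "K = {\<one>}"
    then have "card (carrier G) = card L" using card_carrier cardK by simp
    then have "L = carrier G" using Lsub finite_carrier by (metis card_subset_eq)
    then show False using maximal_subgroupD(3)[OF L] by contradiction
  qed
qed

text \<open>Otherwise every maximal subgroup containing \<open>x\<close> is \<open>C\<^sub>G(x)\<close>, which then meets its
  conjugates trivially.\<close>

lemma exists_maximal_noncentral:
  assumes x: "x \<in> carrier G" "x \<noteq> \<one>"
  shows "\<exists>M. maximal_subgroup M G \<and> x \<in> M \<and> \<not> M \<subseteq> centralizer {x}"
proof (rule ccontr)
  assume no: "\<not> ?thesis"
  have *: "M = centralizer {x}" if "maximal_subgroup M G" "x \<in> M" for M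
  proof -
    have "M \<subseteq> centralizer {x}" using no that by blast
    then show ?thesis by (rule maximal_subgroup_eq_centralizer[OF that(1) x])
  qed
  define L where "L = centralizer {x}"
  have L: "maximal_subgroup L G" using exists_maximal_above_centralizer[OF x] * L_def by metis
  note Lsub = maximal_subgroupD(2)[OF L]
  have xL: "x \<in> L" using x by (simp add: L_def mem_centralizer_singleton)
  obtain g z where g: "g \<in> carrier G" "g \<notin> L" and z: "z \<in> L" "z \<in> conjugate g ` L" "z \<noteq> \<one>"
    using maximal_subgroup_meets_conjugate[OF L] by blast
  have zc: "z \<in> carrier G" using z Lsub by blast
  have Lg: "conjugate g ` L = centralizer {conjugate g x}"
    using g x by (simp add: L_def conjugate_centralizer)
  \<comment> \<open>\<open>z\<close> commutes with \<open>x\<close> and with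
    \<open>conjugate g x\<close>, so \<open>M\<close> contains both. By \<open>*\<close> it equals
    \<open>L\<close>; thus \<open>x\<close> commutes with \<open>conjugate g x\<close> and lies in
    the conjugate of \<open>L\<close> by \<open>g\<close>, which by \<open>*\<close> is again
    \<open>L\<close>.\<close>
  obtain M where M: "maximal_subgroup M G" "centralizer {z} \<subseteq> M"
    using exists_maximal_above_centralizer[OF zc z(3)] by blast
  have "x \<in> centralizer {z}" using z(1) x by (simp add: L_def mem_centralizer_singleton)
  then have "M = L" using * M by (auto simp: L_def)
  moreover have "conjugate g x \<in> centralizer {z}"
    using z(2) x g by (simp add: Lg mem_centralizer_singleton)
  ultimately have "conjugate g x \<in> L" using M by blast
  then have "x \<in> conjugate g ` L" using x g by (simp add: Lg mem_centralizer_singleton) (simp add: L_def mem_centralizer_singleton)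
  then have "conjugate g ` L = L"
    by (rule *[OF maximal_subgroup_conjugate[OF g(1) L], folded L_def])
  then show False using maximal_subgroup_self_normalizing[OF L] g by blast
qed


section \<open>Distances in the graph\<close>

text \<open>Powers of the arc relation make distance bounds add under composition. Exponent 0
  relates every element to itself, vertex or not.\<close>

definition near :: "nat \<Rightarrow> 'a \<Rightarrow> 'a \<Rightarrow> bool" where
  "near n x y \<longleftrightarrow> (\<exists>k \<le> n. (x, y) \<in> parcs (ncng_graph G) ^^ k)"

lemma near_refl: "near n x x"
  unfolding near_def by (rule exI[of _ 0]) simp

lemma near_mono: "near m x y \<Longrightarrow> m \<le> n \<Longrightarrow> near n x y"
  unfolding near_def using le_trans by blast

lemma near_trans:
  assumes "near m x y" "near n y z"
  shows "near (m + n) x z"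
proof -
  obtain j k where "j \<le> m" "(x, y) \<in> parcs (ncng_graph G) ^^ j"
    "k \<le> n" "(y, z) \<in> parcs (ncng_graph G) ^^ k"
    using assms unfolding near_def by blast
  then show ?thesis
    unfolding near_def by (intro exI[of _ "j + k"]) (auto simp: relpow_add)
qed

lemma near_sym:
  assumes "near n x y"
  shows "near n y x"
proof -
  have sym: "(b, a) \<in> parcs (ncng_graph G)" if "(a, b) \<in> parcs (ncng_graph G)" for a b
    using that by (auto simp: ncng_graph_def commutator_eq_one_iff insert_commute)
  have "(b, a) \<in> parcs (ncng_graph G) ^^ k" if "(a, b) \<in> parcs (ncng_graph G) ^^ k" for a b k
    using that
  proof (induction k arbitrary: b)
    case (Suc k)
    then obtain c where "(a, c) \<in> parcs (ncng_graph G) ^^ k" "(c, b) \<in> parcs (ncng_graph G)"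
      by auto
    then show ?case using Suc.IH sym relpow_Suc_I2 by metis
  qed simp
  then show ?thesis using assms by (auto simp: near_def)
qed

text \<open>Elements that do not commute with each other are noncentral, hence vertices.\<close>

lemma near_if_proper:
  assumes "x \<in> carrier G" "y \<in> carrier G" "x \<otimes> y \<noteq> y \<otimes> x" "generate G {x, y} \<noteq> carrier G"
  shows "near 1 x y"
proof -
  have "x \<notin> center G" "y \<notin> center G"
    unfolding center_def using assms by (blast, metis (mono_tags, lifting) mem_Collect_eq)
  then have "(x, y) \<in> parcs (ncng_graph G)"
    using assms by (auto simp: ncng_graph_def commutator_eq_one_iff)
  then show ?thesis unfolding near_def by (intro exI[of _ 1]) simp
qed

lemma near_in_subgroup:
  assumes "subgroup H G" "H \<noteq> carrier G" "x \<in> H" "y \<in> H" "x \<otimes> y \<noteq> y \<otimes> x"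
  shows "near 1 x y"
proof (rule near_if_proper)
  have "generate G {x, y} \<subseteq> H" using assms by (intro generate_subgroup_incl) auto
  then show "generate G {x, y} \<noteq> carrier G" using assms subgroup.subset by blast
qed (use assms subgroup.mem_carrier[OF assms(1)] in auto)

text \<open>The middle vertex is an \<open>h\<close> in \<open>H\<close> that commutes with neither
  \<open>x\<close> nor \<open>y\<close>; both edges stay inside the proper subgroup
  \<open>H\<close>.\<close>

lemma near_noncentral:
  assumes H: "subgroup H G" "H \<noteq> carrier G"
    and x: "x \<in> H" "\<not> H \<subseteq> centralizer {x}" and y: "y \<in> H" "\<not> H \<subseteq> centralizer {y}"
  shows "near 2 x y"
proof -
  obtain h where h: "h \<in> H" "h \<otimes> x \<noteq> x \<otimes> h" "h \<otimes> y \<noteq> y \<otimes> h"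
    using exists_noncommuting_with_both[OF H(1) x(1) y(1) x(2) y(2)] by blast
  have "near 1 x h" by (rule near_in_subgroup[OF H x(1) h(1)]) (use h in simp)
  moreover have "near 1 h y" by (rule near_in_subgroup[OF H h(1) y(1)]) (use h in simp)
  ultimately have "near (1 + 1) x y" by (rule near_trans)
  then show ?thesis by (simp add: numeral_2_eq_2)
qed

lemma near_involutions:
  "\<lbrakk>involution t; involution s; t \<otimes> s \<noteq> s \<otimes> t\<rbrakk> \<Longrightarrow> near 1 t s"
  using near_if_proper involutions_generate_proper by (simp add: involution_def)

lemma conjugate_image_subset_centralizer_iff:
  assumes "g \<in> carrier G" "x \<in> carrier G" "H \<subseteq> carrier G"
  shows "conjugate g ` H \<subseteq> centralizer {conjugate g x} \<longleftrightarrow> H \<subseteq> centralizer {x}"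
proof -
  have "centralizer {x} \<subseteq> carrier G" by (auto simp: centralizer_def)
  moreover have "centralizer {conjugate g x} = conjugate g ` centralizer {x}"
    using assms by (simp add: conjugate_centralizer)
  ultimately show ?thesis
    using assms by (metis conjugate_image_cancel(1) image_mono)
qed

text \<open>If no noncentral involution of \<open>L\<close> is adjacent to one of \<open>M\<close>, then those of \<open>M\<close> centralize
  the \<open>L\<close>-invariant set of those of \<open>L\<close>, hence lie in \<open>L\<close>, and one of them is
  noncentral in both subgroups.\<close>

lemma near_five_if_noncentral_involutions:
  assumes L: "maximal_subgroup L G" "x \<in> L" "\<not> L \<subseteq> centralizer {x}"
    and M: "maximal_subgroup M G" "y \<in> M" "\<not> M \<subseteq> centralizer {y}"
    and t0: "t0 \<in> L" "involution t0" "\<not> L \<subseteq> centralizer {t0}"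
    and s0: "s0 \<in> M" "involution s0" "\<not> M \<subseteq> centralizer {s0}"
  shows "near 5 x y"
proof -
  define I where "I H = {t \<in> H. involution t \<and> \<not> H \<subseteq> centralizer {t}}" for H
  note L' = maximal_subgroupD[OF L(1)] and M' = maximal_subgroupD[OF M(1)]
  have t0I: "t0 \<in> I L" and s0I: "s0 \<in> I M" using t0 s0 by (auto simp: I_def)
  have Isub: "I L \<subseteq> carrier G" by (auto simp: I_def involution_def)
  have conjI: "conjugate h t \<in> I H" if "subgroup H G" "h \<in> H" "t \<in> I H" for H h t
  proof -
    have Hsub: "H \<subseteq> carrier G" using that(1) by (rule subgroup.subset)
    have self: "conjugate h ` H = H" using that by (simp add: conjugate_image_self)
    have t: "t \<in> H" "involution t" "\<not> H \<subseteq> centralizer {t}" using that(3) by (auto simp: I_def)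
    have "\<not> H \<subseteq> centralizer {conjugate h t}"
      using conjugate_image_subset_centralizer_iff[of h t H] self t Hsub that(2) by auto
    moreover have "conjugate h t \<in> H" using self t(1) by blast
    moreover have "involution (conjugate h t)" using conjugate_involution t(2) that(2) Hsub by blast
    ultimately show ?thesis by (simp add: I_def)
  qed
  have two: "near 2 x t" if "t \<in> I L" for t
    using near_noncentral[OF L'(1,3) L(2,3)] that by (auto simp: I_def)
  have two': "near 2 s y" if "s \<in> I M" for s
    using near_noncentral[OF M'(1,3) _ _ M(2,3)] that by (auto simp: I_def)
  show ?thesis
  proof (cases "\<exists>t \<in> I L. \<exists>s \<in> I M. t \<otimes> s \<noteq> s \<otimes> t")
    case True
    then obtain t s where ts: "t \<in> I L" "s \<in> I M" "t \<otimes> s \<noteq> s \<otimes> t" by blast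
    then have "near 1 t s" by (intro near_involutions) (auto simp: I_def)
    then have "near (2 + 1 + 2) x y" using two two' ts near_trans by blast
    then show ?thesis by simp
  next
    case False
    define C where "C = centralizer (I L)"
    have IMC: "I M \<subseteq> C"
    proof
      fix s assume s: "s \<in> I M"
      then have "s \<otimes> t = t \<otimes> s" if "t \<in> I L" for t using False that by metis
      moreover have "s \<in> carrier G" using s by (auto simp: I_def involution_def)
      ultimately show "s \<in> C" by (simp add: C_def centralizer_def)
    qed
    have C: "subgroup C G" unfolding C_def by (rule subgroup_centralizer[OF Isub])
    have "C \<noteq> {\<one>}" using s0I IMC s0(2) by (auto simp: involution_def)
    moreover have "C \<noteq> carrier G"
    proof -
      have "C \<subseteq> centralizer {t0}" using t0I by (auto simp: C_def centralizer_def)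
      moreover have "centralizer {t0} \<subseteq> carrier G" by (auto simp: centralizer_def)
      moreover have "centralizer {t0} \<noteq> carrier G"
        using t0 by (intro centralizer_proper) (auto simp: involution_def)
      ultimately show ?thesis by blast
    qed
    moreover have "conjugate l ` C = C" if l: "l \<in> L" for l
    proof -
      have lc: "l \<in> carrier G" using l L'(2) by blast
      have "conjugate (inv l) t \<in> I L" if "t \<in> I L" for t
        using conjI[OF L'(1) subgroup.m_inv_closed[OF L'(1) l] that] .
      then have "I L \<subseteq> conjugate l ` I L"
        using Isub lc by (auto simp: mem_conjugate_image_iff subset_iff)
      moreover have "conjugate l ` I L \<subseteq> I L" using conjI[OF L'(1) l] by blast
      ultimately have "conjugate l ` I L = I L" by blast
      then show ?thesis using conjugate_centralizer[OF lc Isub] by (simp add: C_def)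
    qed
    \<comment> \<open>\<open>C\<close> is normalized by \<open>L\<close> and by itself, and the
      normalizer of \<open>C\<close> is contained in \<open>L\<close>.\<close>
    ultimately have "g \<in> L" if "g \<in> C" for g
      using normalizer_of_normal_in_maximal[OF L(1) C, of g] that conjugate_image_self[OF C that]
        subgroup.mem_carrier[OF C that] by blast
    then have IML: "I M \<subseteq> L" using IMC by blast
    show ?thesis
    proof (cases "\<exists>s \<in> I M. \<not> L \<subseteq> centralizer {s}")
      case True
      then obtain s where s: "s \<in> I M" "\<not> L \<subseteq> centralizer {s}" by blast
      then have "s \<in> I L" using IML by (auto simp: I_def)
      then have "near (2 + 2) x y" using two two' s near_trans by blast
      then show ?thesis by (rule near_mono) simp
    next
      case False
      \<comment> \<open>Every involution in \<open>I M\<close> is now central in \<open>L\<close>,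
        so its centralizer is \<open>L\<close>. As \<open>M\<close> permutes \<open>I M\<close>, it
        normalizes \<open>L\<close>, and maximality leaves only \<open>L = M\<close>.\<close>
      have eq: "L = centralizer {s}" if "s \<in> I M" for s
        by (rule maximal_subgroup_eq_centralizer[OF L(1)])
          (use False that in \<open>auto simp: I_def involution_def\<close>)
      have "M \<subseteq> L"
      proof
        fix m assume m: "m \<in> M"
        then have mc: "m \<in> carrier G" using M'(2) by blast
        have "conjugate m ` L = conjugate m ` centralizer {s0}" using eq[OF s0I] by simp
        also have "\<dots> = centralizer {conjugate m s0}"
          using mc s0 by (simp add: conjugate_centralizer involution_def)
        also have "\<dots> = L" using eq[OF conjI[OF M'(1) m s0I]] by simp
        finally show "m \<in> L" by (rule maximal_subgroup_self_normalizing[OF L(1) mc])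
      qed
      then have "L = M" using maximal_subgroup_eq[OF M(1) L'(1,3)] by simp
      then have "near 2 x y" using near_noncentral[OF L'(1,3) L(2,3)] M by simp
      then show ?thesis by (rule near_mono) simp
    qed
  qed
qed

section \<open>Maximal subgroups whose involutions are all central\<close>

text \<open>Each involution of \<open>L\<close> has centralizer \<open>L\<close>. An involution
  commuting with one inside \<open>L\<close> and one outside would lie in \<open>L\<close> and pull
  the outer one into \<open>L\<close>; so inner and outer involutions are conjugate. Hence all
  involutions are conjugate, and what holds for \<open>L\<close> carries over to
  \<open>centralizer {r}\<close>.\<close>

lemma central_involutions_structure:
  assumes L: "maximal_subgroup L G" and central: "\<forall>t \<in> L. involution t \<longrightarrow> L \<subseteq> centralizer {t}"
    and r: "involution r"
  shows "maximal_subgroup (centralizer {r}) G"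
    and "\<And>r'. involution r' \<Longrightarrow> r \<otimes> r' = r' \<otimes> r \<Longrightarrow> r' = r"
proof -
  note Lsub = maximal_subgroupD(2)[OF L]
  have L_eq: "L = centralizer {t}" if "t \<in> L" "involution t" for t
    using maximal_subgroup_eq_centralizer[OF L _ _ ] central that by (simp add: involution_def)
  obtain t where t: "t \<in> L" "involution t" using maximal_subgroup_has_involution[OF L] by blast
  have [simp]: "t \<in> carrier G" using t by (simp add: involution_def)
  have conj_L: "conjugate g ` L = centralizer {conjugate g t}" if "g \<in> carrier G" for g
    using L_eq[OF t] that conjugate_centralizer[of g "{t}"] by simp
  \<comment> \<open>The centralizer of \<open>conjugate g t\<close> is the conjugate of
    \<open>L\<close> by \<open>g\<close>; if that involution lies in \<open>L\<close>, the
    centralizer is \<open>L\<close> itself.\<close>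
  have stay: "g \<in> L" if g: "g \<in> carrier G" "conjugate g t \<in> L" for g
  proof (rule maximal_subgroup_self_normalizing[OF L g(1)])
    show "conjugate g ` L = L"
      using conj_L[OF g(1)] L_eq[OF g(2) conjugate_involution[OF g(1) t(2)]] by simp
  qed
  have outside: "\<exists>g \<in> carrier G. conjugate g t' = s"
    if t': "t' \<in> L" "involution t'" and s: "s \<notin> L" "involution s" for t' s
  proof -
    have False if z: "involution z" "z \<otimes> t' = t' \<otimes> z" "z \<otimes> s = s \<otimes> z" for z
    proof -
      have "z \<in> L" using z L_eq[OF t'] by (simp add: mem_centralizer_singleton involution_def)
      then have "L = centralizer {z}" using L_eq z by simp
      then show False using z s by (simp add: mem_centralizer_singleton involution_def)
    qed
    then show ?thesis
      using involutions_commute_or_conjugate[OF finite_carrier t'(2) s(2)] t' s by blast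
  qed
  obtain g0 where g0: "g0 \<in> carrier G" "g0 \<notin> L"
    using maximal_subgroup_meets_conjugate[OF L] by blast
  \<comment> \<open>A conjugate of \<open>t\<close> outside \<open>L\<close>, which links
    \<open>t\<close> to the other involutions inside \<open>L\<close>.\<close>
  define s where "s = conjugate g0 t"
  have s: "s \<notin> L" "involution s"
    using stay g0 t conjugate_involution by (auto simp: s_def)
  have all_conj: "\<exists>g \<in> carrier G. conjugate g t = q" if q: "involution q" for q
  proof (cases "q \<in> L")
    case True
    then obtain b where b: "b \<in> carrier G" "conjugate b q = s" using outside q s by blast
    have "conjugate (inv b \<otimes> g0) t = conjugate (inv b) (conjugate b q)"
      using b g0 by (simp add: conjugate_by_mult s_def)
    also have "\<dots> = q" using b(1) q by (simp add: involution_def)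
    finally show ?thesis using b g0 by blast
  qed (use outside t q in blast)
  obtain g where g: "g \<in> carrier G" "conjugate g t = r" using all_conj[OF r] by blast
  have Lg: "conjugate g ` L = centralizer {r}" using conj_L g by simp
  then show "maximal_subgroup (centralizer {r}) G"
    using maximal_subgroup_conjugate[OF g(1) L] by simp
  fix r' assume r': "involution r'" "r \<otimes> r' = r' \<otimes> r"
  then have r'c: "r' \<in> carrier G" by (simp add: involution_def)
  have "r' \<in> conjugate g ` L" using r' r'c Lg by (simp add: mem_centralizer_singleton)
  then have t'L: "conjugate (inv g) r' \<in> L" using g r'c Lsub by (simp add: mem_conjugate_image_iff)
  \<comment> \<open>By \<open>stay\<close>, \<open>h\<close> lies in
    \<open>L = centralizer {t}\<close> and fixes \<open>t\<close>; so \<open>t\<close> is the only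
    involution of \<open>L\<close>.\<close>
  obtain h where h: "h \<in> carrier G" "conjugate h t = conjugate (inv g) r'"
    using all_conj[OF conjugate_involution[OF _ r'(1)]] g by blast
  then have "h \<in> L" using stay t'L by simp
  then have "conjugate h t = t"
    using L_eq[OF t] h(1) by (simp add: mem_centralizer_singleton conjugate_eq_self_iff)
  then have "conjugate g t = conjugate g (conjugate (inv g) r')" using h by simp
  then show "r' = r" using g r'c by simp
qed

text \<open>If \<open>x\<close> is far from all involutions, then \<open>x\<close> lies in some \<open>L = C\<^sub>G(t)\<close>, and \<open>L\<close> is the only
  maximal subgroup containing any given \<open>l \<in> L\<close> that does not commute with \<open>x\<close>. Then \<open>C\<^sub>G(x)\<close> is
  the only maximal subgroup above \<open>C\<^sub>G(z)\<close> for every \<open>z \<noteq> \<one>\<close> common to \<open>L\<close> and another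
  conjugate of it. As \<open>L\<close> permutes these \<open>z\<close>, it normalizes \<open>C\<^sub>G(x)\<close>, so \<open>x\<close> is
  central in \<open>L\<close>.\<close>

lemma near_involution:
  assumes cmax: "\<And>t. involution t \<Longrightarrow> maximal_subgroup (centralizer {t}) G"
    and comm: "\<And>t s. involution t \<Longrightarrow> involution s \<Longrightarrow> t \<otimes> s = s \<otimes> t \<Longrightarrow> s = t"
    and x: "x \<in> carrier G" "x \<noteq> \<one>"
  shows "\<exists>s. involution s \<and> near 2 x s"
proof (rule ccontr)
  assume "\<not> ?thesis"
  then have far: False if "involution s" "near 2 x s" for s using that by blast
  \<comment> \<open>An involution of \<open>K\<close> that is noncentral in \<open>K\<close> would
    be within distance 2 of \<open>x\<close>.\<close>
  have cent: "\<exists>s. involution s \<and> K = centralizer {s}"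
    if K: "maximal_subgroup K G" "x \<in> K" "\<not> K \<subseteq> centralizer {x}" for K
  proof -
    obtain s where s: "s \<in> K" "involution s" using maximal_subgroup_has_involution[OF K(1)] by blast
    have "K \<subseteq> centralizer {s}"
      using far[OF s(2)] near_noncentral[OF maximal_subgroupD(1,3)[OF K(1)] K(2,3) s(1)] by blast
    then have "K = centralizer {s}"
      using maximal_subgroup_eq_centralizer[OF K(1)] s(2) by (simp add: involution_def)
    then show ?thesis using s(2) by blast
  qed
  obtain L where L: "maximal_subgroup L G" "x \<in> L" "\<not> L \<subseteq> centralizer {x}"
    using exists_maximal_noncentral[OF x] by blast
  obtain t where t: "involution t" and Lt: "L = centralizer {t}" using cent[OF L] by blast
  note L' = maximal_subgroupD[OF L(1)]
  have tc [simp]: "t \<in> carrier G" using t by (simp add: involution_def)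
  have tL: "t \<in> L" by (simp add: Lt mem_centralizer_singleton)
  have xt: "x \<otimes> t = t \<otimes> x" using L(2) by (simp add: Lt mem_centralizer_singleton)
  have only_L: "K = L"
    if l: "l \<in> L" "l \<otimes> x \<noteq> x \<otimes> l" and K: "maximal_subgroup K G" "l \<in> K" for l K
  proof (rule ccontr)
    assume ne: "K \<noteq> L"
    note K' = maximal_subgroupD[OF K(1)]
    have lc [simp]: "l \<in> carrier G" using l L'(2) by blast
    \<comment> \<open>If \<open>t\<close> were the only involution of \<open>K\<close>, then
      \<open>K\<close> would centralize it and lie in \<open>L\<close>.\<close>
    have "\<exists>s \<in> K. involution s \<and> s \<noteq> t"
    proof (rule ccontr)
      assume "\<not> ?thesis"
      then have only_t: "s = t" if "s \<in> K" "involution s" for s using that by blast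
      then have tK: "t \<in> K" using maximal_subgroup_has_involution[OF K(1)] by blast
      have "K \<subseteq> L"
      proof
        fix k assume k: "k \<in> K"
        then have kc: "k \<in> carrier G" using K'(2) by blast
        have "conjugate k t \<in> K" using conjugate_image_self[OF K'(1) k] tK by blast
        then have "conjugate k t = t" using only_t conjugate_involution[OF kc t] by blast
        then show "k \<in> L" using kc by (simp add: Lt mem_centralizer_singleton conjugate_eq_self_iff)
      qed
      then show False using maximal_subgroup_eq[OF K(1) L'(1,3)] ne by simp
    qed
    then obtain s where s: "s \<in> K" "involution s" "s \<noteq> t" by blast
    have sc [simp]: "s \<in> carrier G" using s by (simp add: involution_def)
    \<comment> \<open>Such an \<open>h\<close> would give the walk \<open>x\<close>,
      \<open>h\<close>, \<open>s\<close>, with its first edge inside \<open>L\<close> and its second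
      inside \<open>H\<close>.\<close>
    have far2: False
      if "h \<in> L" "h \<otimes> x \<noteq> x \<otimes> h" "subgroup H G" "H \<noteq> carrier G" "h \<in> H" "s \<in> H" "h \<otimes> s \<noteq> s \<otimes> h" for h H
    proof -
      have "near 1 x h" by (rule near_in_subgroup[OF L'(1,3) L(2) that(1)]) (use that in simp)
      moreover have "near 1 h s" using near_in_subgroup that by blast
      ultimately have "near (1 + 1) x s" by (rule near_trans)
      then show False using far[OF s(2)] by (simp add: numeral_2_eq_2)
    qed
    have ls: "l \<otimes> s = s \<otimes> l" using far2[OF l K'(1,3) K(2) s(1)] by blast
    have lt: "l \<otimes> t = t \<otimes> l" using l(1) by (simp add: Lt mem_centralizer_singleton)
    have "l \<noteq> \<one>" using l x(1) by auto
    then obtain N where N: "maximal_subgroup N G" "centralizer {l} \<subseteq> N" "l \<in> N"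
      using exists_maximal_above_centralizer[OF lc] by blast
    note N' = maximal_subgroupD[OF N(1)]
    have "t \<in> N" "s \<in> N" using N(2) ls lt by (auto simp: mem_centralizer_singleton)
    show False
    \<comment> \<open>\<open>l\<close> commutes with \<open>s\<close>, so
      \<open>t \<otimes> l\<close> replaces it as middle vertex: it does not commute with
      \<open>x\<close>, since \<open>t\<close> does and \<open>l\<close> does not, nor with
      \<open>s\<close>, since \<open>l\<close> does and \<open>t\<close> does not.\<close>
    proof (rule far2[of "t \<otimes> l" N])
      show "t \<otimes> l \<in> L" using tL l subgroup.m_closed[OF L'(1)] by blast
      show "t \<otimes> l \<in> N" using \<open>t \<in> N\<close> N(3) subgroup.m_closed[OF N'(1)] by blast
      have "x \<otimes> (t \<otimes> l) = t \<otimes> (x \<otimes> l)" using x xt by (simp flip: m_assoc)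
      then show "t \<otimes> l \<otimes> x \<noteq> x \<otimes> (t \<otimes> l)" using x l(2) by (simp add: m_assoc)
      have "t \<otimes> l \<otimes> s = t \<otimes> s \<otimes> l" using ls by (simp add: m_assoc)
      moreover have "t \<otimes> s \<noteq> s \<otimes> t" using comm[OF t s(2)] s(3) by blast
      ultimately show "t \<otimes> l \<otimes> s \<noteq> s \<otimes> (t \<otimes> l)" by (simp flip: m_assoc)
    qed (use N' \<open>s \<in> N\<close> in auto)
  qed
  have key: "K = centralizer {x}"
    if g: "g \<in> carrier G" "g \<notin> L" and z: "z \<in> L" "z \<in> conjugate g ` L" "z \<noteq> \<one>"
      and K: "maximal_subgroup K G" "centralizer {z} \<subseteq> K" for g z K
  proof -
    have zc [simp]: "z \<in> carrier G" using z L'(2) by blast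
    have "conjugate g ` L \<noteq> L" using maximal_subgroup_self_normalizing[OF L(1)] g by blast
    then have zx: "z \<otimes> x = x \<otimes> z"
      using only_L[OF z(1) _ maximal_subgroup_conjugate[OF g(1) L(1)] z(2)] by blast
    have "conjugate g ` L = centralizer {conjugate g t}"
      using g conjugate_centralizer[of g "{t}"] by (simp add: Lt)
    then have "z \<otimes> conjugate g t = conjugate g t \<otimes> z" "z \<otimes> t = t \<otimes> z"
      using z by (auto simp: Lt mem_centralizer_singleton)
    then have tK: "conjugate g t \<in> K" "t \<in> K"
      using K(2) g by (auto simp: mem_centralizer_singleton)
    have ne: "conjugate g t \<noteq> t"
      using g by (simp add: Lt mem_centralizer_singleton conjugate_eq_self_iff)
    have "x \<in> K" using K(2) zx x by (auto simp: mem_centralizer_singleton)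
    \<comment> \<open>\<open>K\<close> contains the distinct involutions \<open>t\<close> and
      \<open>conjugate g t\<close>. Were \<open>x\<close> noncentral in \<open>K\<close>, then
      \<open>cent\<close> would give \<open>K = centralizer {s}\<close>, and \<open>comm\<close>
      would identify both with \<open>s\<close>.\<close>
    have "K \<subseteq> centralizer {x}"
    proof (rule ccontr)
      assume "\<not> K \<subseteq> centralizer {x}"
      then obtain s where s: "involution s" "K = centralizer {s}" using cent K(1) \<open>x \<in> K\<close> by blast
      have "s = t" using comm[OF t s(1)] tK(2) s(2) by (simp add: mem_centralizer_singleton)
      moreover have "s = conjugate g t"
        using comm[OF conjugate_involution[OF g(1) t] s(1)] tK(1) s(2) by (simp add: mem_centralizer_singleton)
      ultimately show False using ne by simp
    qed
    then show ?thesis using maximal_subgroup_eq_centralizer[OF K(1) x] by simp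
  qed
  obtain g z where g: "g \<in> carrier G" "g \<notin> L" and z: "z \<in> L" "z \<in> conjugate g ` L" "z \<noteq> \<one>"
    using maximal_subgroup_meets_conjugate[OF L(1)] by blast
  have zc [simp]: "z \<in> carrier G" using z L'(2) by blast
  obtain K where K: "maximal_subgroup K G" "centralizer {z} \<subseteq> K"
    using exists_maximal_above_centralizer[OF zc z(3)] by blast
  have Kx: "K = centralizer {x}" by (rule key[OF g z K])
  have "L \<subseteq> K"
  proof
    fix l assume l: "l \<in> L"
    then have lc [simp]: "l \<in> carrier G" using L'(2) by blast
    have self: "conjugate l ` L = L" by (rule conjugate_image_self[OF L'(1) l])
    \<comment> \<open>\<open>key\<close> applies to \<open>conjugate l z\<close> and
      \<open>l \<otimes> g\<close> as it did to \<open>z\<close> and \<open>g\<close>; hence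
      \<open>l\<close> normalizes \<open>K\<close>.\<close>
    have "conjugate l ` K = centralizer {x}"
    proof (rule key)
      show "l \<otimes> g \<in> carrier G" using g by simp
      show "l \<otimes> g \<notin> L"
      proof
        assume "l \<otimes> g \<in> L"
        then have "inv l \<otimes> (l \<otimes> g) \<in> L"
          using l subgroup.m_closed[OF L'(1)] subgroup.m_inv_closed[OF L'(1)] by blast
        then show False using g by simp
      qed
      show "conjugate l z \<in> L" using self z(1) by blast
      show "conjugate l z \<in> conjugate (l \<otimes> g) ` L"
        using z(2) g L'(2) by (simp add: conjugate_image_mult)
      show "conjugate l z \<noteq> \<one>" using z(3) by simp
      show "maximal_subgroup (conjugate l ` K) G" by (rule maximal_subgroup_conjugate[OF lc K(1)])
      have "centralizer {conjugate l z} = conjugate l ` centralizer {z}"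
        by (simp add: conjugate_centralizer)
      then show "centralizer {conjugate l z} \<subseteq> conjugate l ` K" using K(2) by blast
    qed
    then have "conjugate l ` K = K" by (simp add: Kx)
    then show "l \<in> K" using maximal_subgroup_self_normalizing[OF K(1)] by simp
  qed
  then show False using L(3) Kx by simp
qed

text \<open>The bound arises as 2 + 1 + 2: at most two edges from either end to an involution, and
  at most one between the involutions.\<close>

lemma near_five:
  assumes x: "x \<in> carrier G" "x \<noteq> \<one>" and y: "y \<in> carrier G" "y \<noteq> \<one>"
  shows "near 5 x y"
proof (cases "\<exists>L. maximal_subgroup L G \<and> (\<forall>t \<in> L. involution t \<longrightarrow> L \<subseteq> centralizer {t})")
  case True
  then obtain L where L: "maximal_subgroup L G"
    and central: "\<forall>t \<in> L. involution t \<longrightarrow> L \<subseteq> centralizer {t}"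
    by blast
  note B = central_involutions_structure[OF L central]
  have "\<exists>s. involution s \<and> near 2 z s" if "z \<in> carrier G" "z \<noteq> \<one>" for z
    by (rule near_involution[OF _ _ that]) (use B in blast)+
  then obtain t s where t: "involution t" "near 2 x t" and s: "involution s" "near 2 y s"
    using x y by meson
  \<comment> \<open>Either \<open>t\<close> and \<open>s\<close> do not commute and are adjacent, or
    they coincide.\<close>
  have "near 1 t s"
    using near_involutions[OF t(1) s(1)] B(2)[OF t(1) s(1)] near_refl by metis
  then have "near (2 + 1 + 2) x y" using t(2) near_sym[OF s(2)] near_trans by blast
  then show ?thesis by simp
next
  case False
  obtain L where L: "maximal_subgroup L G" "x \<in> L" "\<not> L \<subseteq> centralizer {x}"
    using exists_maximal_noncentral[OF x] by blast
  obtain M where M: "maximal_subgroup M G" "y \<in> M" "\<not> M \<subseteq> centralizer {y}"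
    using exists_maximal_noncentral[OF y] by blast
  obtain t s where "t \<in> L" "involution t" "\<not> L \<subseteq> centralizer {t}"
    and "s \<in> M" "involution s" "\<not> M \<subseteq> centralizer {s}"
    using False L(1) M(1) by meson
  then show ?thesis using near_five_if_noncentral_involutions L M by blast
qed

section \<open>From distance bounds to walks in the graph\<close>

lemma pverts_ncng_graph: "pverts (ncng_graph G) = carrier G - {\<one>}"
proof -
  have "z = \<one>" if "z \<in> center G" for z
  proof (rule ccontr)
    assume "z \<noteq> \<one>"
    then have "centralizer {z} \<noteq> carrier G" using that by (intro centralizer_proper) (auto simp: center_def)
    then show False using that by (auto simp: center_def centralizer_def)
  qed
  moreover have "\<one> \<in> center G" by (auto simp: center_def)
  ultimately have "center G = {\<one>}" by blast
  then show ?thesis by (simp add: ncng_graph_def)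
qed

end

text \<open>By induction on the length, peeling off the first arc. The start must be a vertex
  because the empty walk is based at one.\<close>

lemma relpow_parcs_imp_awalk:
  assumes "pair_wf_digraph \<Gamma>" "(u, v) \<in> parcs \<Gamma> ^^ k" "u \<in> pverts \<Gamma>"
  shows "\<exists>p. pre_digraph.awalk (with_proj \<Gamma>) u p v \<and> length p = k"
  using assms(2,3)
proof (induction k arbitrary: u)
  case 0
  interpret pair_wf_digraph \<Gamma> by (rule assms(1))
  show ?case using 0 by (auto simp: awalk_Nil_iff)
next
  case (Suc k)
  interpret pair_wf_digraph \<Gamma> by (rule assms(1))
  obtain w where w: "(u, w) \<in> parcs \<Gamma>" "(w, v) \<in> parcs \<Gamma> ^^ k"
    using relpow_Suc_D2[OF Suc.prems(1)] by blast
  then have "w \<in> pverts \<Gamma>" using arc_snd_in_verts by force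
  then obtain p where "awalk w p v" "length p = k" using Suc.IH w(2) by blast
  then show ?case using w(1) by (intro exI[of _ "(u, w) # p"]) (simp add: awalk_Cons_iff)
qed

theorem proposition1p5:
  fixes G :: "('a, 'b) monoid_scheme"
  assumes "simple_group G"
    and "finite (carrier G)"
    and "\<not> comm_group G"
    and "\<And>M. maximal_subgroup M G \<Longrightarrow> even (card M)"
  shows "Digraph_Component.connected (with_proj (ncng_graph G)) \<and>
         diameter (with_proj (ncng_graph G)) \<le> 5"
proof
  interpret even_maximal_simple_group G
    using assms by (intro even_maximal_simple_group.intro even_maximal_simple_group_axioms.intro) auto
  interpret \<Gamma>: pair_graph "ncng_graph G" by (rule pair_graph_ncng_graph[OF finite_carrier])
  have walk: "\<exists>p. \<Gamma>.awalk u p v \<and> length p \<le> 5"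
    if "u \<in> pverts (ncng_graph G)" "v \<in> pverts (ncng_graph G)" for u v
    using near_five[of u v] relpow_parcs_imp_awalk[OF \<Gamma>.pair_wf_digraph_axioms _ that(1)] that
    unfolding near_def pverts_ncng_graph by blast
  show "diameter (with_proj (ncng_graph G)) \<le> 5"
  proof -
    have "graph_dist (with_proj (ncng_graph G)) u v \<le> enat 5"
      if "u \<in> pverts (ncng_graph G)" "v \<in> pverts (ncng_graph G)" for u v
      using walk[OF that] by (simp add: graph_dist_le_iff)
    then show ?thesis unfolding diameter_def by (auto intro!: SUP_least simp: numeral_eq_enat)
  qed
  have "pverts (ncng_graph G) \<noteq> {}" using simple_not_triv by (auto simp: pverts_ncng_graph)
  moreover have "(u, v) \<in> rtrancl_on (pverts (ncng_graph G)) ((arcs_ends (with_proj (ncng_graph G)))\<^sup>s)"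
    if "u \<in> pverts (ncng_graph G)" "v \<in> pverts (ncng_graph G)" for u v
  proof -
    have "u \<rightarrow>\<^sup>*\<^bsub>with_proj (ncng_graph G)\<^esub> v" using walk[OF that] \<Gamma>.reachable_awalk by blast
    \<comment> \<open>\<open>connected\<close> refers to the symmetric closure of the arcs, which
      contains the arcs themselves, so reachability carries over by monotonicity.\<close>
    then show ?thesis
      unfolding reachable_def by (rule rtrancl_on_mono[rotated 2]) (auto simp: symcl_def)
  qed
  ultimately show "Digraph_Component.connected (with_proj (ncng_graph G))"
    by (simp add: connected_conv)
qed

end
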